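(* For every sentence $\varphi$ of arithmetic: there is a program $p$ with $p\Vdash_{>0}\varphi$ if and only if $\varphi$ is true in $\mathbb N$.
   Context: Sentences are in the first-order language of arithmetic ($0,S,+,\cdot,=$). Programs are oracle Turing programs, identified with natural-number codes via a fixed computable enumeration; for a program $p$, oracle $u\in 2^\omega$ and $n\in\mathbb N$, $p^u(n)$ is the output of $p$ on input $n$ with oracle $u$. For a program $p$ and $i\in\mathbb N$, $p(i)$ denotes the oracle program which, on oracle $u$, runs the program with code $p^u(i)$ on oracle $u$. $\mu$ is the Lebesgue (fair-coin) measure on $2^\omega$; $\mathcal F_{>0}$ is the family of subsets of $2^\omega$ of positive measure. $p\Vdash_{>0}\varphi$ is defined by recursion, with $\mathcal F=\mathcal F_{>0}$: never $p\Vdash_{>0}\bot$; $p\Vdash_{>0}t=s$ iff $t,s$ have the same value; $p\Vdash_{>0}\psi_0\wedge\psi_1$ iff $p(i)\Vdash_{>0}\psi_i$ for $i<2$; $p\Vdash_{>0}\psi_0\vee\psi_1$ iff there are $O\in\mathcal F$ and $i<2$ such that for all $u\in O$, $p^u(0)=i$ and $p^u(1)\Vdash_{>0}\psi_i$; $p\Vdash_{>0}\varphi\to\psi$ iff there is $O\in\mathcal F$ such that for all $u\in O$ and all $s\Vdash_{>0}\varphi$, $p^u(s)\Vdash_{>0}\psi$; $p\Vdash_{>0}\exists x\varphi$ iff there are $O\in\mathcal F$ and $n$ such that for all $u\in O$, $p^u(0)=n$ and $p^u(1)\Vdash_{>0}\varphi(n)$; $p\Vdash_{>0}\forall x\varphi$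 iff there is $O\in\mathcal F$ such that for all $u\in O$ and all $n$, $p^u(n)\Vdash_{>0}\varphi(n)$. *)

theory Defs
  imports "HOL-Probability.Probability" "HOL-Library.Nat_Bijection"
begin

section \<open>Sentences of arithmetic\<close>

datatype tm = Var nat | Zero | Succ tm | Add tm tm | Mul tm tm

datatype fm =
    Falsum
  | Equal tm tm
  | Conj fm fm
  | Disj fm fm
  | Impl fm fm
  | Exists nat fm
  | Forall nat fm

primrec fv_tm :: "tm \<Rightarrow> nat set" where
  "fv_tm (Var x) = {x}"
| "fv_tm Zero = {}"
| "fv_tm (Succ t) = fv_tm t"
| "fv_tm (Add t s) = fv_tm t \<union> fv_tm s"
| "fv_tm (Mul t s) = fv_tm t \<union> fv_tm s"

primrec fv :: "fm \<Rightarrow> nat set" where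
  "fv Falsum = {}"
| "fv (Equal t s) = fv_tm t \<union> fv_tm s"
| "fv (Conj \<phi> \<psi>) = fv \<phi> \<union> fv \<psi>"
| "fv (Disj \<phi> \<psi>) = fv \<phi> \<union> fv \<psi>"
| "fv (Impl \<phi> \<psi>) = fv \<phi> \<union> fv \<psi>"
| "fv (Exists x \<phi>) = fv \<phi> - {x}"
| "fv (Forall x \<phi>) = fv \<phi> - {x}"

definition sentence :: "fm \<Rightarrow> bool" where
  "sentence \<phi> \<longleftrightarrow> fv \<phi> = {}"

primrec val :: "(nat \<Rightarrow> nat) \<Rightarrow> tm \<Rightarrow> nat" where
  "val e (Var x) = e x"
| "val e Zero = 0"
| "val e (Succ t) = Suc (val e t)"
| "val e (Add t s) = val e t + val e s"
| "val e (Mul t s) = val e t * val e s"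

primrec sat :: "(nat \<Rightarrow> nat) \<Rightarrow> fm \<Rightarrow> bool" where
  "sat e Falsum \<longleftrightarrow> False"
| "sat e (Equal t s) \<longleftrightarrow> val e t = val e s"
| "sat e (Conj \<phi> \<psi>) \<longleftrightarrow> sat e \<phi> \<and> sat e \<psi>"
| "sat e (Disj \<phi> \<psi>) \<longleftrightarrow> sat e \<phi> \<or> sat e \<psi>"
| "sat e (Impl \<phi> \<psi>) \<longleftrightarrow> (sat e \<phi> \<longrightarrow> sat e \<psi>)"
| "sat e (Exists x \<phi>) \<longleftrightarrow> (\<exists>n. sat (e(x := n)) \<phi>)"
| "sat e (Forall x \<phi>) \<longleftrightarrow> (\<forall>n. sat (e(x := n)) \<phi>)"

definition true_in_nat :: "fm \<Rightarrow> bool" where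
  "true_in_nat \<phi> \<longleftrightarrow> (\<forall>e. sat e \<phi>)"

primrec numeral_tm :: "nat \<Rightarrow> tm" where
  "numeral_tm 0 = Zero"
| "numeral_tm (Suc n) = Succ (numeral_tm n)"

primrec subst_tm :: "nat \<Rightarrow> nat \<Rightarrow> tm \<Rightarrow> tm" where
  "subst_tm x n (Var y) = (if y = x then numeral_tm n else Var y)"
| "subst_tm x n Zero = Zero"
| "subst_tm x n (Succ t) = Succ (subst_tm x n t)"
| "subst_tm x n (Add t s) = Add (subst_tm x n t) (subst_tm x n s)"
| "subst_tm x n (Mul t s) = Mul (subst_tm x n t) (subst_tm x n s)"

(* subst x n phi replaces the free occurrences of variable x in phi by the numeral
  of n. Numerals are closed, so no variable can be captured. *)

primrec subst :: "nat \<Rightarrow> nat \<Rightarrow> fm \<Rightarrow> fm" where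
  "subst x n Falsum = Falsum"
| "subst x n (Equal t s) = Equal (subst_tm x n t) (subst_tm x n s)"
| "subst x n (Conj \<phi> \<psi>) = Conj (subst x n \<phi>) (subst x n \<psi>)"
| "subst x n (Disj \<phi> \<psi>) = Disj (subst x n \<phi>) (subst x n \<psi>)"
| "subst x n (Impl \<phi> \<psi>) = Impl (subst x n \<phi>) (subst x n \<psi>)"
| "subst x n (Exists y \<phi>) = Exists y (if y = x then \<phi> else subst x n \<phi>)"
| "subst x n (Forall y \<phi>) = Forall y (if y = x then \<phi> else subst x n \<phi>)"

primrec complexity :: "fm \<Rightarrow> nat" where
  "complexity Falsum = 0"
| "complexity (Equal t s) = 0"
| "complexity (Conj \<phi> \<psi>) = Suc (complexity \<phi> + complexity \<psi>)"
| "complexity (Disj \<phi> \<psi>) = Suc (complexity \<phi> + complexity \<psi>)"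
| "complexity (Impl \<phi> \<psi>) = Suc (complexity \<phi> + complexity \<psi>)"
| "complexity (Exists x \<phi>) = Suc (complexity \<phi>)"
| "complexity (Forall x \<phi>) = Suc (complexity \<phi>)"

lemma complexity_subst [simp]: "complexity (subst x n \<phi>) = complexity \<phi>"
  by (induction \<phi>) auto

section \<open>Oracle Turing programs\<close>

type_synonym cantor = "nat \<Rightarrow> bool"

datatype move = MoveL | Stay | MoveR

(* An oracle Turing machine has a two-way infinite work tape over blank and 1 (False and
  True) and a two-way infinite read-only oracle tape over blank, 0 and 1 (None,
  Some False and Some True), on which the bits u 0, u 1, ... are written from cell 0
  onwards. A rule ((q, a, b), (q', b', X, Y)) says: in state q, reading a on the oracle
  tape and b on the work tape, go to state q', write b' on the work tape, and move the
  oracle head by X and the work head by Y. If several rules of a machine apply, the first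
  one in the list is used, so a list of rules denotes a finite partial transition function. *)

type_synonym rule = "(nat \<times> bool option \<times> bool) \<times> (nat \<times> bool \<times> move \<times> move)"

type_synonym machine = "rule list"

datatype config = Config (state: nat) (opos: int) (wpos: int) (tape: "int \<Rightarrow> bool")

primrec displacement :: "move \<Rightarrow> int" where
  "displacement MoveL = - 1"
| "displacement Stay = 0"
| "displacement MoveR = 1"

definition oracle_cell :: "cantor \<Rightarrow> int \<Rightarrow> bool option" where
  "oracle_cell u i = (if i < 0 then None else Some (u (nat i)))"

(* State 0 is the halting state. A machine without an applicable rule in another state stays
  there forever and therefore never halts. *)

definition step :: "machine \<Rightarrow> cantor \<Rightarrow> config \<Rightarrow> config" where
  "step M u c =
    (if state c = 0 then c
     else case map_of M (state c, oracle_cell u (opos c), tape c (wpos c)) of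
       None \<Rightarrow> c
     | Some (q, b, X, Y) \<Rightarrow>
         Config q (opos c + displacement X) (wpos c + displacement Y)
           ((tape c)(wpos c := b)))"

(* The start state is 1. The input n is represented by n + 1 consecutive 1s, and the
  output is the number of 1s on the work tape when the machine halts. *)

definition initial :: "nat \<Rightarrow> config" where
  "initial n = Config 1 0 0 (\<lambda>i. 0 \<le> i \<and> i \<le> int n)"

definition config_at :: "machine \<Rightarrow> cantor \<Rightarrow> nat \<Rightarrow> nat \<Rightarrow> config" where
  "config_at M u n k = (step M u ^^ k) (initial n)"

definition ones :: "config \<Rightarrow> nat" where
  "ones c = card {i. tape c i}"

definition compute :: "machine \<Rightarrow> cantor \<Rightarrow> nat \<Rightarrow> nat option" where
  "compute M u n =
    (if \<exists>k. state (config_at M u n k) = 0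
     then Some (ones (config_at M u n (LEAST k. state (config_at M u n k) = 0)))
     else None)"

(* The enumeration of all machines. Every natural number is the code of a machine. *)

definition decode_bit :: "nat \<Rightarrow> bool" where
  "decode_bit k = (k \<noteq> 0)"

definition decode_symbol :: "nat \<Rightarrow> bool option" where
  "decode_symbol k = (if k = 0 then None else Some (k \<noteq> 1))"

definition decode_move :: "nat \<Rightarrow> move" where
  "decode_move k = (if k = 0 then MoveL else if k = 1 then Stay else MoveR)"

definition decode_rule :: "nat \<Rightarrow> rule" where
  "decode_rule k =
    (let (q, k1) = prod_decode k;
         (a, k2) = prod_decode k1;
         (b, k3) = prod_decode k2;
         (q', k4) = prod_decode k3;
         (b', k5) = prod_decode k4;
         (X, Y) = prod_decode k5
     in ((q, decode_symbol a, decode_bit b),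
         (q', decode_bit b', decode_move X, decode_move Y)))"

definition decode_machine :: "nat \<Rightarrow> machine" where
  "decode_machine p = map decode_rule (list_decode p)"

lemma surj_decode_machine: "surj decode_machine"
proof -
  have bit: "\<exists>k. decode_bit k = b" for b
    by (rule exI[of _ "of_bool b"]) (simp add: decode_bit_def)
  have symbol: "\<exists>k. decode_symbol k = a" for a
    by (rule exI[of _ "case a of None \<Rightarrow> 0 | Some b \<Rightarrow> if b then 2 else 1"])
      (simp add: decode_symbol_def split: option.split)
  have move: "\<exists>k. decode_move k = X" for X
    by (rule exI[of _ "case X of MoveL \<Rightarrow> 0 | Stay \<Rightarrow> 1 | MoveR \<Rightarrow> 2"])
      (simp add: decode_move_def split: move.split)
  have "\<exists>k. decode_rule k = r" for r
  proof -
    obtain q a b q' b' X Y where r: "r = ((q, a, b), (q', b', X, Y))"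
      by (metis prod.collapse)
    obtain ka kb kb' kX kY where "decode_symbol ka = a" "decode_bit kb = b"
      "decode_bit kb' = b'" "decode_move kX = X" "decode_move kY = Y"
      using bit symbol move by metis
    then have "decode_rule (prod_encode (q, prod_encode (ka, prod_encode (kb, prod_encode (q',
        prod_encode (kb', prod_encode (kX, kY))))))) = r"
      by (simp add: decode_rule_def r)
    then show ?thesis ..
  qed
  then obtain g where g: "\<And>r. decode_rule (g r) = r"
    by metis
  have "decode_machine (list_encode (map g M)) = M" for M
    by (simp add: decode_machine_def o_def g)
  then show ?thesis
    by (rule surjI)
qed

(* run p u n is the value p^u(n), and None if the computation diverges. *)

definition run :: "nat \<Rightarrow> cantor \<Rightarrow> nat \<Rightarrow> nat option" where
  "run p = compute (decode_machine p)"

(* is_app p i q says that q is a code of the program p(i). Such a code exists, since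
  there is a universal oracle machine; it is unique up to extensional equality, which is all that
  realizability depends on (see realizes_cong below). *)

definition is_app :: "nat \<Rightarrow> nat \<Rightarrow> nat \<Rightarrow> bool" where
  "is_app p i q \<longleftrightarrow> (\<forall>u n. run q u n = Option.bind (run p u i) (\<lambda>c. run c u n))"

section \<open>Realizability with positive measure\<close>

(* Lebesgue measure on Cantor space: the completion of the fair-coin product measure. *)

definition cantor_measure :: "cantor measure" where
  "cantor_measure = completion (PiM UNIV (\<lambda>_. measure_pmf (bernoulli_pmf (1/2))))"

definition positive_sets :: "cantor set set" where
  "positive_sets = {A \<in> sets cantor_measure. emeasure cantor_measure A > 0}"

function realizes :: "nat \<Rightarrow> fm \<Rightarrow> bool" where
  "realizes p Falsum \<longleftrightarrow> False"
| "realizes p (Equal t s) \<longleftrightarrow> (\<forall>e. val e t = val e s)"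
| "realizes p (Conj \<phi> \<psi>) \<longleftrightarrow>
     (\<exists>q. is_app p 0 q \<and> realizes q \<phi>) \<and> (\<exists>q. is_app p 1 q \<and> realizes q \<psi>)"
| "realizes p (Disj \<phi> \<psi>) \<longleftrightarrow>
     (\<exists>A \<in> positive_sets. \<exists>i<2. \<forall>u\<in>A.
        run p u 0 = Some i \<and>
        (\<exists>q. run p u 1 = Some q \<and> realizes q (if i = 0 then \<phi> else \<psi>)))"
| "realizes p (Impl \<phi> \<psi>) \<longleftrightarrow>
     (\<exists>A \<in> positive_sets. \<forall>u\<in>A. \<forall>s. realizes s \<phi> \<longrightarrow>
        (\<exists>q. run p u s = Some q \<and> realizes q \<psi>))"
| "realizes p (Exists x \<phi>) \<longleftrightarrow>
     (\<exists>A \<in> positive_sets. \<exists>n. \<forall>u\<in>A.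
        run p u 0 = Some n \<and>
        (\<exists>q. run p u 1 = Some q \<and> realizes q (subst x n \<phi>)))"
| "realizes p (Forall x \<phi>) \<longleftrightarrow>
     (\<exists>A \<in> positive_sets. \<forall>u\<in>A. \<forall>n.
        \<exists>q. run p u n = Some q \<and> realizes q (subst x n \<phi>))"
  by pat_completeness auto
termination
  by (relation "Wellfounded.measure (\<lambda>(p, \<phi>). complexity \<phi>)") auto

lemma realizes_cong:
  assumes "run p = run p'"
  shows "realizes p \<phi> \<longleftrightarrow> realizes p' \<phi>"
proof -
  have "is_app p = is_app p'"
    using assms by (simp add: is_app_def fun_eq_iff)
  with assms show ?thesis
    by (cases \<phi>) simp_all
qed

end

(* The index of a true disjunct and the witness of an existential statement may be guessed from
  the oracle, since a guess only has to be right with positive probability. Hence one program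
  realizes all true sentences that differ only in their terms: a disjunction takes the first
  oracle bit as its index, an existential quantifier takes the number of leading 1s of the
  oracle as its witness, and all other clauses return constants, namely codes of the programs
  for the immediate subformulas. Witnesses need not be computable, so truth suffices. *)

theory Submission
  imports Defs
begin

section \<open>Truth of sentences, substitution of numerals, and formulas up to their terms\<close>

section \<open>Sentences\<close>

lemma val_cong: "(\<And>x. x \<in> fv_tm t \<Longrightarrow> e x = e' x) \<Longrightarrow> val e t = val e' t"
  by (induction t) auto

lemma sat_cong: "(\<And>x. x \<in> fv \<phi> \<Longrightarrow> e x = e' x) \<Longrightarrow> sat e \<phi> \<longleftrightarrow> sat e' \<phi>"
proof (induction \<phi> arbitrary: e e')
  case (Equal t s)
  then show ?case using val_cong[of t e e'] val_cong[of s e e'] by simp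
next
  case (Conj \<phi> \<psi>)
  have "sat e \<phi> \<longleftrightarrow> sat e' \<phi>" "sat e \<psi> \<longleftrightarrow> sat e' \<psi>"
    by (rule Conj.IH, use Conj.prems in simp)+
  then show ?case by simp
next
  case (Disj \<phi> \<psi>)
  have "sat e \<phi> \<longleftrightarrow> sat e' \<phi>" "sat e \<psi> \<longleftrightarrow> sat e' \<psi>"
    by (rule Disj.IH, use Disj.prems in simp)+
  then show ?case by simp
next
  case (Impl \<phi> \<psi>)
  have "sat e \<phi> \<longleftrightarrow> sat e' \<phi>" "sat e \<psi> \<longleftrightarrow> sat e' \<psi>"
    by (rule Impl.IH, use Impl.prems in simp)+
  then show ?case by simp
next
  case (Exists x \<phi>)
  have "sat (e(x := n)) \<phi> \<longleftrightarrow> sat (e'(x := n)) \<phi>" for n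
    by (rule Exists.IH) (use Exists.prems in auto)
  then show ?case by simp
next
  case (Forall x \<phi>)
  have "sat (e(x := n)) \<phi> \<longleftrightarrow> sat (e'(x := n)) \<phi>" for n
    by (rule Forall.IH) (use Forall.prems in auto)
  then show ?case by simp
qed simp

text \<open>A sentence has no free variable through which an assignment could matter, so truth can
  be tested at a single \<open>e\<close>.\<close>

lemma true_in_nat_iff_sat: "sentence \<phi> \<Longrightarrow> true_in_nat \<phi> \<longleftrightarrow> sat e \<phi>"
  unfolding sentence_def true_in_nat_def by (metis empty_iff sat_cong)

lemma fv_numeral_tm [simp]: "fv_tm (numeral_tm n) = {}"
  by (induction n) auto

lemma val_numeral_tm [simp]: "val e (numeral_tm n) = n"
  by (induction n) auto

lemma fv_subst_tm [simp]: "fv_tm (subst_tm x n t) = fv_tm t - {x}"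
  by (induction t) auto

lemma fv_subst [simp]: "fv (subst x n \<phi>) = fv \<phi> - {x}"
  by (induction \<phi>) auto

lemma val_subst_tm [simp]: "val e (subst_tm x n t) = val (e(x := n)) t"
  by (induction t) auto

text \<open>A numeral has the same value under every assignment, so substituting it acts like
  updating \<open>e\<close>. At a quantifier, the update for the bound variable either overrides
  this one or commutes with it.\<close>

lemma sat_subst [simp]: "sat e (subst x n \<phi>) \<longleftrightarrow> sat (e(x := n)) \<phi>"
proof (induction \<phi> arbitrary: e)
  case (Exists y \<phi>)
  show ?case
  proof (cases "y = x")
    case True
    then show ?thesis by (simp only: subst.simps sat.simps fun_upd_upd if_True simp_thms)
  next
    case False
    then show ?thesis
      by (simp only: subst.simps sat.simps Exists.IH if_False simp_thms fun_upd_twist[OF False])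
  qed
next
  case (Forall y \<phi>)
  show ?case
  proof (cases "y = x")
    case True
    then show ?thesis by (simp only: subst.simps sat.simps fun_upd_upd if_True simp_thms)
  next
    case False
    then show ?thesis
      by (simp only: subst.simps sat.simps Forall.IH if_False simp_thms fun_upd_twist[OF False])
  qed
qed simp_all

text \<open>Substituting numerals changes only terms, so all instances of a quantified formula share
  a skeleton. The realizers constructed below depend on nothing else.\<close>

primrec skeleton :: "fm \<Rightarrow> fm" where
  "skeleton Falsum = Falsum"
| "skeleton (Equal t s) = Equal Zero Zero"
| "skeleton (Conj \<phi> \<psi>) = Conj (skeleton \<phi>) (skeleton \<psi>)"
| "skeleton (Disj \<phi> \<psi>) = Disj (skeleton \<phi>) (skeleton \<psi>)"
| "skeleton (Impl \<phi> \<psi>) = Impl (skeleton \<phi>) (skeleton \<psi>)"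
| "skeleton (Exists x \<phi>) = Exists x (skeleton \<phi>)"
| "skeleton (Forall x \<phi>) = Forall x (skeleton \<phi>)"

lemma skeleton_subst [simp]: "skeleton (subst x n \<phi>) = skeleton \<phi>"
  by (induction \<phi>) auto

section \<open>Positivity of cylinders in Cantor space\<close>

section \<open>Positive sets\<close>

text \<open>Each prescribed bit contributes a factor 1/2, and a product of finitely many positive
  factors is positive.\<close>

lemma cylinder_positive: "{u. \<forall>i\<in>J. u i = v i} \<in> positive_sets" if "finite J"
proof -
  let ?P = "PiM UNIV (\<lambda>_::nat. measure_pmf (bernoulli_pmf (1/2)))"
  interpret product_prob_space "\<lambda>_::nat. measure_pmf (bernoulli_pmf (1/2))" UNIV
    by unfold_locales
  let ?A = "{u \<in> space ?P. \<forall>i\<in>J. u i \<in> {v i}}"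
  have eq: "{u. \<forall>i\<in>J. u i = v i} = ?A"
    by (simp add: space_PiM)
  have "{u \<in> space ?P. u i \<in> {v i}} \<in> sets ?P" for i
    using measurable_sets[OF measurable_component_singleton[of i UNIV "\<lambda>_. measure_pmf (bernoulli_pmf (1/2))"], of "{v i}"]
    by (simp add: vimage_def Int_def conj_commute)
  then have sets: "?A \<in> sets ?P"
    using that by (intro sets.sets_Collect_finite_All)
  have "emeasure ?P ?A = (\<Prod>i\<in>J. emeasure (measure_pmf (bernoulli_pmf (1/2))) {v i})"
    by (rule emeasure_PiM_Collect) (use that in auto)
  also have "\<dots> > 0"
  proof -
    have "pmf (bernoulli_pmf (1/2)) b > 0" for b
      by (cases b) auto
    then show ?thesis
      using that by (simp add: emeasure_pmf_single prod_ennreal zero_less_iff_neq_zero)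
  qed
  finally show ?thesis
    unfolding eq positive_sets_def cantor_measure_def
    using sets by (simp add: sets_completionI_sets)
qed

lemma UNIV_positive: "UNIV \<in> positive_sets"
  using cylinder_positive[of "{}"] by simp

lemma empty_not_positive: "{} \<notin> positive_sets"
  by (simp add: positive_sets_def)

section \<open>Halting computations and codes for finite transition functions\<close>

section \<open>Machines that guess\<close>

text \<open>State 0 is never left and \<open>step\<close> fixes every configuration in it, so the
  output may be read off at any halting time, not only at the least one.\<close>

lemma compute_eqI:
  assumes "state (config_at M u n k) = 0"
  shows "compute M u n = Some (ones (config_at M u n k))"
proof -
  let ?l = "LEAST k. state (config_at M u n k) = 0"
  have l: "state (config_at M u n ?l) = 0" "?l \<le> k"
    using assms by (auto intro: LeastI Least_le)
  have "config_at M u n (?l + j) = config_at M u n ?l" for j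
    by (induction j) (use l in \<open>auto simp: config_at_def step_def\<close>)
  with l(2) have "config_at M u n k = config_at M u n ?l"
    by (metis le_add_diff_inverse)
  with assms show ?thesis
    unfolding compute_def by auto
qed

text \<open>Every list of rules has a code, so a machine may be given by its transition function
  instead of a list.\<close>

lemma program_of_transition_function:
  assumes "finite (dom \<delta>)"
  shows "\<exists>p. map_of (decode_machine p) = \<delta>"
proof -
  obtain ks where ks: "set ks = dom \<delta>"
    using finite_list[OF assms] by auto
  \<comment> \<open>Each key is paired with its own value under \<open>\<delta>\<close>, so the
    order of \<open>ks\<close> and repetitions in it do not affect the lookup.\<close>
  have "map_of (map (\<lambda>k. (k, the (\<delta> k))) ks) x = \<delta> x" for x
    unfolding map_of_map_restrict ks restrict_map_def domIff
    by (cases "\<delta> x = None") (simp_all only: o_apply option.collapse if_True if_False simp_thms)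
  then have "map_of (map (\<lambda>k. (k, the (\<delta> k))) ks) = \<delta>" ..
  moreover obtain p where "map (\<lambda>k. (k, the (\<delta> k))) ks = decode_machine p"
    using surj_decode_machine by (rule surjE)
  ultimately show ?thesis
    by (intro exI[of _ p]) (simp only:)
qed

text \<open>Steps are added at the front, so a run is verified in the order in which it happens,
  without counting its steps.\<close>

inductive reaches :: "machine \<Rightarrow> cantor \<Rightarrow> config \<Rightarrow> config \<Rightarrow> bool" for M u where
  refl: "reaches M u c c"
| step: "reaches M u (step M u c) d \<Longrightarrow> reaches M u c d"

lemma reaches_stepI: "step M u c = c' \<Longrightarrow> reaches M u c' d \<Longrightarrow> reaches M u c d"
  by (simp add: reaches.step)

lemma reaches_imp_funpow: "reaches M u c d \<Longrightarrow> \<exists>k. d = (step M u ^^ k) c"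
proof (induction rule: reaches.induct)
  case (refl c)
  show ?case by (rule exI[of _ 0]) simp
next
  case (step c d)
  then obtain k where "d = (step M u ^^ k) (step M u c)" by blast
  then have "d = (step M u ^^ Suc k) c" by (simp only: funpow_Suc_right o_apply)
  then show ?case ..
qed

lemma compute_reaches:
  assumes "reaches M u (initial n) d" "state d = 0"
  shows "compute M u n = Some (ones d)"
  using reaches_imp_funpow[OF assms(1)] assms(2) compute_eqI[of M u n]
  by (auto simp: config_at_def)

(* State 3 + k, for k > 0, appends k 1s to the tape. *)
definition write_state :: "nat \<Rightarrow> nat" where
  "write_state k = (if k = 0 then 0 else 3 + k)"

(* The input 0 leads to state 2 on a blank tape, where r takes over. Every other
  input leads to the output f b, where b is the first oracle bit. N bounds the outputs. *)
definition guess ::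
  "(bool \<Rightarrow> nat \<times> bool \<times> move \<times> move) \<Rightarrow> (bool \<Rightarrow> nat) \<Rightarrow> nat \<Rightarrow>
    nat \<times> bool option \<times> bool \<rightharpoonup> nat \<times> bool \<times> move \<times> move" where
  "guess r f N = (\<lambda>(q, a, b). case a of None \<Rightarrow> None | Some i \<Rightarrow>
     if q = 1 \<and> b then Some (2, False, Stay, MoveR)
     else if (q = 2 \<or> q = 3) \<and> b then Some (3, False, Stay, MoveR)
     else if q = 2 then Some (r i)
     else if q = 3 then Some (write_state (f i), False, Stay, Stay)
     else if 4 \<le> q \<and> q < 4 + N \<and> \<not> b then Some (write_state (q - 4), True, Stay, MoveR)
     else None)"

text \<open>Here the bound \<open>N\<close> pays off: only states below \<open>4 + N\<close> have
  rules, and both tape alphabets are finite.\<close>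

lemma finite_dom_guess: "finite (dom (guess r f N))"
proof (rule finite_subset)
  show "dom (guess r f N) \<subseteq> {..<4 + N} \<times> UNIV \<times> UNIV"
    by (auto simp: guess_def split: option.splits if_splits)
qed simp

section \<open>Runs of the guessing machine\<close>

context
  fixes M :: machine and u :: cantor and r f N
  assumes M: "map_of M = guess r f N"
begin

text \<open>Writing the oracle position as \<open>int j\<close> keeps the head on cells that carry
  an oracle bit, so the blank case of \<open>guess\<close> does not arise.\<close>

lemma step_guess:
  "step M u (Config q (int j) w T) =
    (if q = 0 then Config q (int j) w T
     else case guess r f N (q, Some (u j), T w) of
       None \<Rightarrow> Config q (int j) w T
     | Some (q', b, X, Y) \<Rightarrow>
         Config q' (int j + displacement X) (w + displacement Y) (T(w := b)))"
  by (auto simp: step_def M oracle_cell_def split: option.split)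

text \<open>The state counts down while 1s are appended. As the cells from \<open>w\<close> onwards
  are blank, every 1 written is new and raises the count by one.\<close>

lemma reaches_write:
  "k \<le> N \<Longrightarrow> finite {i. T i} \<Longrightarrow> (\<And>i. i \<ge> w \<Longrightarrow> \<not> T i) \<Longrightarrow>
    \<exists>d. reaches M u (Config (write_state k) (int j) w T) d \<and> state d = 0 \<and>
      ones d = ones (Config 0 0 0 T) + k"
proof (induction k arbitrary: w T)
  case 0
  show ?case
    by (rule exI, rule conjI, rule reaches.refl) (simp add: write_state_def ones_def)
next
  case (Suc k)
  \<comment> \<open>\<open>write_state (Suc k)\<close> is state \<open>4 + k\<close>; it has a rule
    because \<open>Suc k \<le> N\<close>, and that rule leads to
    \<open>write_state k\<close>.\<close>
  have s: "step M u (Config (write_state (Suc k)) (int j) w T)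
      = Config (write_state k) (int j) (w + 1) (T(w := True))"
    using Suc.prems by (auto simp: step_guess write_state_def guess_def)
  have e: "{i. (T(w := True)) i} = insert w {i. T i}"
    by auto
  have o: "ones (Config 0 0 0 (T(w := True))) = Suc (ones (Config 0 0 0 T))"
    unfolding ones_def config.sel e using Suc.prems by simp
  have "finite {i. (T(w := True)) i}"
    unfolding e using Suc.prems by simp
  moreover have "\<not> (T(w := True)) i" if "i \<ge> w + 1" for i
    using Suc.prems that by simp
  ultimately obtain d where "reaches M u (Config (write_state k) (int j) (w + 1) (T(w := True))) d"
      "state d = 0" "ones d = Suc (ones (Config 0 0 0 T)) + k"
    using Suc.IH[of "T(w := True)" "w + 1"] Suc.prems(1) unfolding o by (metis Suc_leD)
  then show ?case
    using reaches_stepI[OF s] by (intro exI[of _ d]) simp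
qed

lemma compute_const:
  assumes "reaches M u (initial n) (Config (write_state k) (int j) w (\<lambda>_. False))" "k \<le> N"
  shows "compute M u n = Some k"
proof -
  obtain d where d: "reaches M u (Config (write_state k) (int j) w (\<lambda>_. False)) d" "state d = 0" "ones d = k"
    using reaches_write[of k "\<lambda>_. False" w j] assms(2) by (auto simp: ones_def)
  have "reaches M u c e \<Longrightarrow> reaches M u e d \<Longrightarrow> reaches M u c d" for c e
    by (induction rule: reaches.induct) (auto intro: reaches.step)
  from this[OF assms(1) d(1)] d show ?thesis
    by (metis compute_reaches)
qed

text \<open>State 3 sweeps right over the remaining 1s. The oracle head rests on cell 0, so at the
  first blank the answer is chosen by \<open>u 0\<close>.\<close>

lemma reaches_erase:
  "reaches M u (Config 3 0 w (\<lambda>i. w \<le> i \<and> i < w + int k))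
    (Config (write_state (f (u 0))) 0 (w + int k) (\<lambda>_. False))"
proof (induction k arbitrary: w)
  case 0
  have *: "(\<lambda>i. w \<le> i \<and> i < w + int 0) = (\<lambda>_. False)"
    by auto
  show ?case
    unfolding * by (rule reaches.step) (use step_guess[of 3 0] in \<open>simp add: guess_def fun_upd_idem reaches.refl\<close>)
next
  case (Suc k)
  have "(\<lambda>i. w \<le> i \<and> i < w + int (Suc k))(w := False) = (\<lambda>i. w + 1 \<le> i \<and> i < w + 1 + int k)"
    by (rule ext) auto
  then have "step M u (Config 3 0 w (\<lambda>i. w \<le> i \<and> i < w + int (Suc k)))
      = Config 3 0 (w + 1) (\<lambda>i. w + 1 \<le> i \<and> i < w + 1 + int k)"
    using step_guess[of 3 0] by (simp add: guess_def)
  from reaches_stepI[OF this Suc.IH[of "w + 1"]] show ?case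
    by (simp only: of_nat_Suc add.assoc)
qed

text \<open>Input \<open>n\<close> is a block of \<open>n + 1\<close> 1s. Erasing the first leaves a
  blank under the head exactly when \<open>n = 0\<close>, which is how state 2 tells input 0 from
  the others.\<close>

lemma step_initial: "step M u (initial n) = Config 2 0 1 (\<lambda>i. 1 \<le> i \<and> i < 1 + int n)"
  using step_guess[of 1 0] by (auto simp: initial_def guess_def fun_eq_iff)

lemma compute_pos:
  assumes "f (u 0) \<le> N"
  shows "compute M u (Suc n) = Some (f (u 0))"
proof -
  have "(\<lambda>i. 1 \<le> i \<and> i < 1 + int (Suc n))(1 := False) = (\<lambda>i. 2 \<le> i \<and> i < 2 + int n)"
    by (rule ext) auto
  then have "step M u (step M u (initial (Suc n))) = Config 3 0 2 (\<lambda>i. 2 \<le> i \<and> i < 2 + int n)"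
    unfolding step_initial using step_guess[of 2 0] by (simp add: guess_def)
  then have "reaches M u (initial (Suc n)) (Config (write_state (f (u 0))) 0 (2 + int n) (\<lambda>_. False))"
    by (intro reaches.step[of M u "initial (Suc n)"] reaches_stepI[OF _ reaches_erase[of 2 n]])
  with compute_const[where j = 0] assms show ?thesis by simp
qed

lemma step_initial_0: "step M u (initial 0) = Config 2 0 1 (\<lambda>_. False)"
  unfolding step_initial by auto

lemma compute_0:
  assumes "r (u 0) = (write_state k, False, Stay, Stay)" "k \<le> N"
  shows "compute M u 0 = Some k"
proof -
  have "step M u (step M u (initial 0)) = Config (write_state k) 0 1 (\<lambda>_. False)"
    unfolding step_initial_0 using step_guess[of 2 0] assms by (auto simp: guess_def)
  then have "reaches M u (initial 0) (Config (write_state k) 0 1 (\<lambda>_. False))"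
    by (intro reaches.step[of M u "initial 0"] reaches_stepI[OF _ reaches.refl])
  with compute_const[where j = 0] assms show ?thesis by simp
qed

text \<open>In this loop both heads move right together, copying the leading 1s of the oracle to the
  work tape. The work head is one cell ahead because the loop starts at work cell 1; the first
  oracle 0 halts it.\<close>

lemma reaches_count:
  assumes "r = (\<lambda>i. if i then (2, True, MoveR, MoveR) else (0, False, Stay, Stay))"
    and "\<forall>i<j + k. u i" "\<not> u (j + k)"
  shows "reaches M u (Config 2 (int j) (1 + int j) (\<lambda>i. 1 \<le> i \<and> i < 1 + int j))
    (Config 0 (int (j + k)) (1 + int (j + k)) (\<lambda>i. 1 \<le> i \<and> i < 1 + int (j + k)))"
  using assms(2,3)
proof (induction k arbitrary: j)
  case 0
  have "(\<lambda>i. 1 \<le> i \<and> i < 1 + int j)(1 + int j := False) = (\<lambda>i. 1 \<le> i \<and> i < 1 + int j)"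
    by (rule ext) auto
  then have "step M u (Config 2 (int j) (1 + int j) (\<lambda>i. 1 \<le> i \<and> i < 1 + int j))
      = Config 0 (int j) (1 + int j) (\<lambda>i. 1 \<le> i \<and> i < 1 + int j)"
    unfolding step_guess using 0 assms(1) by (simp add: guess_def)
  from reaches_stepI[OF this reaches.refl] show ?case
    by (simp only: add_0_right)
next
  case (Suc k)
  have "(\<lambda>i. 1 \<le> i \<and> i < 1 + int j)(1 + int j := True) = (\<lambda>i. 1 \<le> i \<and> i < 1 + int (Suc j))"
    by (rule ext) auto
  then have s: "step M u (Config 2 (int j) (1 + int j) (\<lambda>i. 1 \<le> i \<and> i < 1 + int j))
      = Config 2 (int (Suc j)) (1 + int (Suc j)) (\<lambda>i. 1 \<le> i \<and> i < 1 + int (Suc j))"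
    unfolding step_guess using Suc.prems(1) assms(1) by (simp add: guess_def add_ac)
  have "\<forall>i<Suc j + k. u i" "\<not> u (Suc j + k)"
    using Suc.prems unfolding add_Suc_shift by blast+
  then show ?case
    using reaches_stepI[OF s] Suc.IH[of "Suc j"] unfolding add_Suc_shift by blast
qed

lemma compute_count:
  assumes "r = (\<lambda>i. if i then (2, True, MoveR, MoveR) else (0, False, Stay, Stay))"
    and "\<forall>i<k. u i" "\<not> u k"
  shows "compute M u 0 = Some k"
proof -
  let ?d = "Config 0 (int k) (1 + int k) (\<lambda>i. 1 \<le> i \<and> i < 1 + int k)"
  have empty: "(\<lambda>i. 1 \<le> i \<and> i < 1 + int 0) = (\<lambda>_. False)"
    by auto
  have "reaches M u (Config 2 (int 0) (1 + int 0) (\<lambda>_. False)) ?d"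
    using reaches_count[OF assms(1), of 0 k] assms(2,3) unfolding empty add_0 by blast
  then have "reaches M u (step M u (initial 0)) ?d"
    by (simp only: step_initial_0 of_nat_0 add_0_right)
  then have "compute M u 0 = Some (ones ?d)"
    by (intro compute_reaches[OF reaches.step]) simp_all
  moreover have "{i. 1 \<le> i \<and> i < 1 + int k} = {1..<1 + int k}"
    by auto
  ultimately show ?thesis
    by (simp add: ones_def)
qed

end

section \<open>The programs from which realizers are built\<close>

lemma ex_bit_program:
  "\<exists>p. \<forall>u. run p u 0 = Some (g (u 0)) \<and> (\<forall>n. run p u (Suc n) = Some (f (u 0)))"
proof -
  \<comment> \<open>The sum dominates all four possible outputs, so finitely many writing states
    suffice.\<close>
  define N where "N = g False + g True + f False + f True"
  have N: "g b \<le> N" "f b \<le> N" for b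
    by (cases b; simp add: N_def)+
  obtain p where p: "map_of (decode_machine p)
      = guess (\<lambda>b. (write_state (g b), False, Stay, Stay)) f N"
    using program_of_transition_function[OF finite_dom_guess] by blast
  show ?thesis
    using compute_0[OF p] compute_pos[OF p] N by (auto simp: run_def intro!: exI[of _ p])
qed

text \<open>Input 0 asks for the guessed witness, input 1 for the code \<open>a\<close> of its
  realizer. Nothing is claimed on input 0 for the all-1s oracle, where the count never ends.\<close>

lemma ex_count_program:
  "\<exists>p. \<forall>u. run p u 1 = Some a \<and> (\<forall>k. (\<forall>i<k. u i) \<and> \<not> u k \<longrightarrow> run p u 0 = Some k)"
proof -
  obtain p where p: "map_of (decode_machine p)
      = guess (\<lambda>i. if i then (2, True, MoveR, MoveR) else (0, False, Stay, Stay)) (\<lambda>_. a) a"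
    using program_of_transition_function[OF finite_dom_guess] by blast
  show ?thesis
    using compute_count[OF p] compute_pos[OF p, of _ 0] by (auto simp: run_def intro!: exI[of _ p])
qed

lemma ex_const_program: "\<exists>p. \<forall>u n. run p u n = Some a"
proof -
  obtain p where "\<forall>u. run p u 0 = Some a \<and> (\<forall>n. run p u (Suc n) = Some a)"
    using ex_bit_program[of "\<lambda>_. a" "\<lambda>_. a"] by blast
  then have "run p u n = Some a" for u n
    by (cases n) auto
  then show ?thesis by blast
qed

section \<open>Equivalence of realizability and truth, uniformly in the skeleton\<close>

section \<open>Uniform realizers\<close>

text \<open>Running \<open>p(i)\<close> on \<open>u\<close> means running the code returned by
  \<open>p\<close> on \<open>u\<close>; if this is always \<open>q\<close>, then \<open>q\<close>
  itself represents \<open>p(i)\<close>. The components of a conjunction are supplied in this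
  way.\<close>

lemma is_app_const: "(\<And>u. run p u i = Some q) \<Longrightarrow> is_app p i q"
  by (simp add: is_app_def)

text \<open>One program must serve all instances of a quantified formula, so that its code can be
  built into a program before the instance is known.\<close>

definition uniform_realizer :: "nat \<Rightarrow> fm \<Rightarrow> bool" where
  "uniform_realizer p \<phi> \<longleftrightarrow>
    (\<forall>\<phi>'. skeleton \<phi>' = skeleton \<phi> \<longrightarrow> sentence \<phi>' \<longrightarrow> true_in_nat \<phi>' \<longrightarrow> realizes p \<phi>')"

text \<open>Ranging over a whole skeleton lets structural induction reach the instances
  \<open>subst x n \<phi>\<close>, which are not subformulas.\<close>

definition sound :: "fm \<Rightarrow> bool" where
  "sound \<phi> \<longleftrightarrow>
    (\<forall>\<phi>' p. skeleton \<phi>' = skeleton \<phi> \<longrightarrow> sentence \<phi>' \<longrightarrow> realizes p \<phi>' \<longrightarrow> true_in_nat \<phi>')"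

lemma uniform_realizerD:
  "uniform_realizer p \<phi> \<Longrightarrow> skeleton \<phi>' = skeleton \<phi> \<Longrightarrow> sentence \<phi>' \<Longrightarrow> true_in_nat \<phi>' \<Longrightarrow> realizes p \<phi>'"
  by (simp add: uniform_realizer_def)

lemma soundD:
  "sound \<phi> \<Longrightarrow> skeleton \<phi>' = skeleton \<phi> \<Longrightarrow> sentence \<phi>' \<Longrightarrow> realizes p \<phi>' \<Longrightarrow> true_in_nat \<phi>'"
  unfolding sound_def by blast

lemma sentence_subst [simp]:
  "sentence (Exists x \<phi>) \<Longrightarrow> sentence (subst x n \<phi>)"
  "sentence (Forall x \<phi>) \<Longrightarrow> sentence (subst x n \<phi>)"
  by (simp_all add: sentence_def)

lemma sentence_connective [simp]:
  "sentence (Conj \<phi> \<psi>) \<longleftrightarrow> sentence \<phi> \<and> sentence \<psi>"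
  "sentence (Disj \<phi> \<psi>) \<longleftrightarrow> sentence \<phi> \<and> sentence \<psi>"
  "sentence (Impl \<phi> \<psi>) \<longleftrightarrow> sentence \<phi> \<and> sentence \<psi>"
  by (simp_all add: sentence_def)

text \<open>Quantification over all assignments need not commute with disjunction, implication or
  existence. For sentences, one fixed assignment decides truth, and there the clauses of
  \<open>sat\<close> apply.\<close>

lemma true_in_nat_connective [simp]:
  "sentence (Conj \<phi> \<psi>) \<Longrightarrow> true_in_nat (Conj \<phi> \<psi>) \<longleftrightarrow> true_in_nat \<phi> \<and> true_in_nat \<psi>"
  "sentence (Disj \<phi> \<psi>) \<Longrightarrow> true_in_nat (Disj \<phi> \<psi>) \<longleftrightarrow> true_in_nat \<phi> \<or> true_in_nat \<psi>"
  "sentence (Impl \<phi> \<psi>) \<Longrightarrow> true_in_nat (Impl \<phi> \<psi>) \<longleftrightarrow> (true_in_nat \<phi> \<longrightarrow> true_in_nat \<psi>)"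
  "sentence (Exists x \<phi>) \<Longrightarrow> true_in_nat (Exists x \<phi>) \<longleftrightarrow> (\<exists>n. true_in_nat (subst x n \<phi>))"
  "sentence (Forall x \<phi>) \<Longrightarrow> true_in_nat (Forall x \<phi>) \<longleftrightarrow> (\<forall>n. true_in_nat (subst x n \<phi>))"
  by (simp_all add: true_in_nat_iff_sat[where e = "\<lambda>_. 0"])

lemma skeleton_eqE:
  "skeleton \<theta> = Falsum \<Longrightarrow> \<theta> = Falsum"
  "skeleton \<theta> = Equal Zero Zero \<Longrightarrow> \<exists>t s. \<theta> = Equal t s"
  "skeleton \<theta> = Conj \<alpha> \<beta> \<Longrightarrow> \<exists>\<phi> \<psi>. \<theta> = Conj \<phi> \<psi> \<and> skeleton \<phi> = \<alpha> \<and> skeleton \<psi> = \<beta>"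
  "skeleton \<theta> = Disj \<alpha> \<beta> \<Longrightarrow> \<exists>\<phi> \<psi>. \<theta> = Disj \<phi> \<psi> \<and> skeleton \<phi> = \<alpha> \<and> skeleton \<psi> = \<beta>"
  "skeleton \<theta> = Impl \<alpha> \<beta> \<Longrightarrow> \<exists>\<phi> \<psi>. \<theta> = Impl \<phi> \<psi> \<and> skeleton \<phi> = \<alpha> \<and> skeleton \<psi> = \<beta>"
  "skeleton \<theta> = Exists x \<alpha> \<Longrightarrow> \<exists>\<phi>. \<theta> = Exists x \<phi> \<and> skeleton \<phi> = \<alpha>"
  "skeleton \<theta> = Forall x \<alpha> \<Longrightarrow> \<exists>\<phi>. \<theta> = Forall x \<phi> \<and> skeleton \<phi> = \<alpha>"
  by (cases \<theta>; simp)+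

text \<open>This is all that soundness uses of positivity: a single oracle from the set already
  yields the required realizers.\<close>

lemma positive_witness: "A \<in> positive_sets \<Longrightarrow> \<exists>u. u \<in> A"
  using empty_not_positive by (metis ex_in_conv)

(* Soundness and completeness have to be proved simultaneously because of implication. *)
lemma sound_and_uniform: "sound \<phi> \<and> (\<exists>p. uniform_realizer p \<phi>)"
proof (induction \<phi>)
  case Falsum
  show ?case
    by (auto simp: sound_def uniform_realizer_def true_in_nat_def dest!: skeleton_eqE)
next
  case (Equal t s)
  show ?case
    by (auto simp: sound_def uniform_realizer_def true_in_nat_def dest!: skeleton_eqE)
next
  case (Conj \<phi> \<psi>)
  then obtain a b where ab: "uniform_realizer a \<phi>" "uniform_realizer b \<psi>" by blast
  obtain p where p: "\<And>u. run p u 0 = Some a" "\<And>u n. run p u (Suc n) = Some b"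
    using ex_bit_program[of "\<lambda>_. a" "\<lambda>_. b"] by blast
  have "is_app p 0 a" "is_app p 1 b"
    using p by (simp_all add: is_app_const)
  then have "uniform_realizer p (Conj \<phi> \<psi>)"
    using ab unfolding uniform_realizer_def
    by (fastforce dest!: skeleton_eqE)
  moreover have "sound (Conj \<phi> \<psi>)"
    using Conj.IH unfolding sound_def by (fastforce dest!: skeleton_eqE)
  ultimately show ?case by blast
next
  case (Disj \<phi> \<psi>)
  then obtain a b where ab: "uniform_realizer a \<phi>" "uniform_realizer b \<psi>" by blast
  \<comment> \<open>The first oracle bit selects both the index and the matching code: 0 goes with
    \<open>a\<close>, 1 with \<open>b\<close>.\<close>
  obtain p where p: "\<And>u. run p u 0 = Some (of_bool (u 0))"
      "\<And>u n. run p u (Suc n) = Some (if u 0 then b else a)"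
    using ex_bit_program[of of_bool "\<lambda>i. if i then b else a"] by blast
  have "realizes p (Disj \<phi>' \<psi>')"
    if "(if i then realizes b \<psi>' else realizes a \<phi>')" for i \<phi>' \<psi>'
  proof -
    \<comment> \<open>These are the oracles on which the guess \<open>i\<close> is made; for a
      correct \<open>i\<close> they form the set demanded by the definition.\<close>
    have "{u. u 0 = i} \<in> positive_sets"
      using cylinder_positive[of "{0}" "\<lambda>_. i"] by simp
    then show ?thesis
      unfolding realizes.simps
      by (rule bexI[rotated], intro exI[of _ "of_bool i"])
        (use p(1) p(2)[of _ 0] that in \<open>auto split: if_splits\<close>)
  qed
  from this[of False] this[of True] have "uniform_realizer p (Disj \<phi> \<psi>)"
    using ab unfolding uniform_realizer_def
    by (auto simp del: realizes.simps dest!: skeleton_eqE)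
  moreover have "sound (Disj \<phi> \<psi>)"
    unfolding sound_def
  proof (intro allI impI)
    fix \<theta> p assume \<theta>: "skeleton \<theta> = skeleton (Disj \<phi> \<psi>)" "sentence \<theta>" "realizes p \<theta>"
    then obtain \<phi>' \<psi>' where e: "\<theta> = Disj \<phi>' \<psi>'" "skeleton \<phi>' = skeleton \<phi>" "skeleton \<psi>' = skeleton \<psi>"
      by (auto dest!: skeleton_eqE)
    from \<theta>(3) obtain q i where "realizes q (if i = (0::nat) then \<phi>' else \<psi>')"
      unfolding e realizes.simps by (metis positive_witness)
    with Disj.IH e \<theta>(2) show "true_in_nat \<theta>"
      unfolding sound_def by (auto split: if_splits)
  qed
  ultimately show ?case by blast
next
  case (Impl \<phi> \<psi>)
  then obtain a b where ab: "uniform_realizer a \<phi>" "uniform_realizer b \<psi>" by blast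
  obtain p where p: "\<And>u n. run p u n = Some b"
    using ex_const_program by blast
  have "uniform_realizer p (Impl \<phi> \<psi>)"
    unfolding uniform_realizer_def
  proof (intro allI impI)
    fix \<theta> assume \<theta>: "skeleton \<theta> = skeleton (Impl \<phi> \<psi>)" "sentence \<theta>" "true_in_nat \<theta>"
    then obtain \<phi>' \<psi>' where e: "\<theta> = Impl \<phi>' \<psi>'" "skeleton \<phi>' = skeleton \<phi>" "skeleton \<psi>' = skeleton \<psi>"
      by (auto dest!: skeleton_eqE)
    \<comment> \<open>The argument \<open>s\<close> serves only as evidence: by soundness the
      premise is true, hence so is the conclusion, which \<open>b\<close> realizes.\<close>
    have "realizes b \<psi>'" if "realizes s \<phi>'" for s
      using soundD[of \<phi> \<phi>' s] that uniform_realizerD[OF ab(2), of \<psi>'] \<theta> e Impl.IH by simp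
    then show "realizes p \<theta>"
      unfolding e realizes.simps by (intro bexI[OF _ UNIV_positive]) (simp add: p)
  qed
  moreover have "sound (Impl \<phi> \<psi>)"
    unfolding sound_def
  proof (intro allI impI)
    fix \<theta> p assume \<theta>: "skeleton \<theta> = skeleton (Impl \<phi> \<psi>)" "sentence \<theta>" "realizes p \<theta>"
    then obtain \<phi>' \<psi>' where e: "\<theta> = Impl \<phi>' \<psi>'" "skeleton \<phi>' = skeleton \<phi>" "skeleton \<psi>' = skeleton \<psi>"
      by (auto dest!: skeleton_eqE)
    have "true_in_nat \<psi>'" if "true_in_nat \<phi>'"
    proof -
      \<comment> \<open>Completeness for the premise provides an actual input on which
        \<open>p\<close> can be run.\<close>
      have "realizes a \<phi>'"
        using uniform_realizerD[OF ab(1) e(2)] that \<theta>(2) e(1) by simp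
      with \<theta>(3) obtain q where "realizes q \<psi>'"
        unfolding e realizes.simps by (metis positive_witness)
      with soundD[of \<psi> \<psi>' q] e \<theta>(2) Impl.IH show ?thesis by simp
    qed
    with e \<theta>(2) show "true_in_nat \<theta>" by simp
  qed
  ultimately show ?case by blast
next
  case (Exists x \<phi>)
  then obtain a where a: "uniform_realizer a \<phi>" by blast
  obtain p where p: "\<And>u. run p u 1 = Some a"
      "\<And>u k. \<forall>i<k. u i \<Longrightarrow> \<not> u k \<Longrightarrow> run p u 0 = Some k"
    using ex_count_program[of a] by blast
  have "uniform_realizer p (Exists x \<phi>)"
    unfolding uniform_realizer_def
  proof (intro allI impI)
    fix \<theta> assume \<theta>: "skeleton \<theta> = skeleton (Exists x \<phi>)" "sentence \<theta>" "true_in_nat \<theta>"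
    then obtain \<phi>' where e: "\<theta> = Exists x \<phi>'" "skeleton \<phi>' = skeleton \<phi>"
      by (auto dest!: skeleton_eqE)
    with \<theta> obtain n where "true_in_nat (subst x n \<phi>')"
      by auto
    \<comment> \<open>The witness \<open>n\<close> comes from truth alone; \<open>a\<close> was
      fixed earlier, but realizes every true instance.\<close>
    with \<theta> e a have "realizes a (subst x n \<phi>')"
      by (intro uniform_realizerD) simp_all
    \<comment> \<open>The cylinder prescribes the bits 0 to \<open>n\<close>: first \<open>n\<close>
      1s, then the 0 that stops the count.\<close>
    moreover have "run p u 0 = Some n" if "\<forall>i\<in>{..n}. u i = (i < n)" for u
      using that by (intro p(2)) auto
    ultimately show "realizes p \<theta>"
      unfolding e realizes.simps
      by (intro bexI[OF _ cylinder_positive[of "{..n}" "\<lambda>i. i < n"]] exI[of _ n]) (auto simp: p(1)[simplified])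
  qed
  moreover have "sound (Exists x \<phi>)"
    unfolding sound_def
  proof (intro allI impI)
    fix \<theta> p assume \<theta>: "skeleton \<theta> = skeleton (Exists x \<phi>)" "sentence \<theta>" "realizes p \<theta>"
    then obtain \<phi>' where e: "\<theta> = Exists x \<phi>'" "skeleton \<phi>' = skeleton \<phi>"
      by (auto dest!: skeleton_eqE)
    from \<theta>(3) obtain q n where "realizes q (subst x n \<phi>')"
      unfolding e realizes.simps by (metis positive_witness)
    with soundD[of \<phi> "subst x n \<phi>'" q] e \<theta>(2) Exists.IH show "true_in_nat \<theta>" by auto
  qed
  ultimately show ?case by blast
next
  case (Forall x \<phi>)
  then obtain a where a: "uniform_realizer a \<phi>" by blast
  obtain p where p: "\<And>u n. run p u n = Some a"
    using ex_const_program by blast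
  have "uniform_realizer p (Forall x \<phi>)"
    unfolding uniform_realizer_def
  proof (intro allI impI)
    fix \<theta> assume \<theta>: "skeleton \<theta> = skeleton (Forall x \<phi>)" "sentence \<theta>" "true_in_nat \<theta>"
    then obtain \<phi>' where e: "\<theta> = Forall x \<phi>'" "skeleton \<phi>' = skeleton \<phi>"
      by (auto dest!: skeleton_eqE)
    \<comment> \<open>All instances are true and share one skeleton, so the constant answer
      \<open>a\<close> is right for every \<open>n\<close>.\<close>
    have "realizes a (subst x n \<phi>')" for n
      using \<theta> e by (intro uniform_realizerD[OF a]) simp_all
    then show "realizes p \<theta>"
      unfolding e realizes.simps by (intro bexI[OF _ UNIV_positive]) (simp add: p)
  qed
  moreover have "sound (Forall x \<phi>)"
    unfolding sound_def
  proof (intro allI impI)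
    fix \<theta> p assume \<theta>: "skeleton \<theta> = skeleton (Forall x \<phi>)" "sentence \<theta>" "realizes p \<theta>"
    then obtain \<phi>' where e: "\<theta> = Forall x \<phi>'" "skeleton \<phi>' = skeleton \<phi>"
      by (auto dest!: skeleton_eqE)
    from \<theta>(3) have "\<exists>q. realizes q (subst x n \<phi>')" for n
      unfolding e realizes.simps by (metis positive_witness)
    with soundD[of \<phi> "subst x _ \<phi>'"] e \<theta>(2) Forall.IH show "true_in_nat \<theta>"
      by (metis sentence_subst(2) skeleton_subst true_in_nat_connective(5))
  qed
  ultimately show ?case by blast
qed

theorem theorem7:
  fixes \<phi> :: fm
  assumes "sentence \<phi>"
  shows "(\<exists>p. realizes p \<phi>) \<longleftrightarrow> true_in_nat \<phi>"
  using sound_and_uniform[of \<phi>] assms unfolding sound_def uniform_realizer_def by blast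

end
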